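(* Let $\mathcal H$ be a finite-dimensional complex Hilbert space of dimension $d$ with orthonormal basis containing vectors $|0\rangle,|1\rangle$. Let $S\subset \mathbb B(\mathcal H)$ satisfy $S=S^*$ (where $S^*=\{s^*:s\in S\}$), be such that $\mathrm{span}(S)$ is a Hörmander system, and contain $a=|0\rangle\langle 1|$. Then $\mathrm{Channel}(S)$ is transitive.
   Context: $\mathbb B(\mathcal H)$ is the algebra of linear operators on $\mathcal H$; $\mathcal D(\mathcal H)=\{\rho\in\mathbb B(\mathcal H):\rho=\rho^*,\rho\ge 0,\mathrm{tr}\,\rho=1\}$ is the set of states. All spans are complex linear spans. Hörmander system: a set of anti-Hermitian operators on a $d$-dimensional space whose iterated commutators span $\mathfrak{su}(d)$. A resource set $S$ (or $\mathrm{span}(S)$) that also contains non-anti-Hermitian operators is called a Hörmander system if the real Lie algebra generated by the anti-Hermitian operators in $\mathrm{span}(S)$ contains $\mathfrak{su}(d)$. For $a\in\mathbb B(\mathcal H)$ let $L_a(\rho)=2a\rho a^*-a^*a\rho-\rho a^*a$. $\mathrm{Channel}(S)$ is the smallest class of maps on $\mathbb B(\mathcal H)$ such that: (UN) if $iH\in\mathrm{span}(S)$ is anti-Hermitian, then $\rho\mapsto e^{itH}\rho e^{-itH}$ belongs to the class for all $t\ge 0$; (JU) for every $a\in S$ and $t\ge 0$, $e^{tL_a}$ belongs to the class; (CO) the class is closed under composition. A set $\mathcal O$ of operations is transitive if for all $\rho,\sigma\in\mathcal D(\mathcal H)$ there is $\Phi\in\mathcal O$ with $\Phi(\rho)=\sigma$,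 or (continuous setting) there is a family $(T_t)_{t\ge0}$ in $\mathcal O$ with $T_\tau(\rho)=\sigma$ for some $\tau>0$ or $\lim_{t\to\infty}T_t(\rho)=\sigma$. *)

theory Defs
  imports "HOL-Analysis.Analysis"
begin

text \<open>
  The Hilbert space is \<open>complex ^ 'n\<close>, of dimension \<open>CARD('n)\<close>; its linear operators are the
  square matrices \<open>complex ^ 'n ^ 'n\<close>, acting by \<open>*v\<close>.
\<close>

definition cinner :: "complex ^ 'n \<Rightarrow> complex ^ 'n \<Rightarrow> complex" where
  "cinner u v = (\<Sum>i\<in>UNIV. cnj (u $ i) * v $ i)"

definition orthonormal_basis :: "(complex ^ 'n) set \<Rightarrow> bool" where
  "orthonormal_basis B \<longleftrightarrow>
     (\<forall>u\<in>B. \<forall>v\<in>B. cinner u v = (if u = v then 1 else 0)) \<and> vec.span B = UNIV"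

text \<open>The operator \<open>|u\<rangle>\<langle>v|\<close>.\<close>

definition ketbra :: "complex ^ 'n \<Rightarrow> complex ^ 'n \<Rightarrow> complex ^ 'n ^ 'n" where
  "ketbra u v = (\<chi> i j. u $ i * cnj (v $ j))"

definition cadjoint :: "complex ^ 'n ^ 'n \<Rightarrow> complex ^ 'n ^ 'n" where
  "cadjoint A = (\<chi> i j. cnj (A $ j $ i))"

text \<open>
  On a matrix type \<open>*s\<close> scales rows by entries of a vector, so multiplication of an operator by a
  complex number is introduced separately; \<open>cmat.span\<close> is then the complex linear span.
\<close>

definition cscale :: "complex \<Rightarrow> complex ^ 'n ^ 'n \<Rightarrow> complex ^ 'n ^ 'n" where
  "cscale c A = (\<chi> i j. c * A $ i $ j)"

global_interpretation cmat: vector_space cscale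
  by unfold_locales (simp_all add: cscale_def vec_eq_iff algebra_simps)

definition antihermitian :: "complex ^ 'n ^ 'n \<Rightarrow> bool" where
  "antihermitian A \<longleftrightarrow> cadjoint A = - A"

definition states :: "(complex ^ 'n ^ 'n) set" where
  "states = {\<rho>. \<rho> = cadjoint \<rho> \<and> (\<forall>v. cinner v (\<rho> *v v) \<in> \<real>\<^sub>\<ge>\<^sub>0) \<and> trace \<rho> = 1}"

text \<open>\<open>subspace\<close> is the real notion, so this is the generated \<^emph>\<open>real\<close> Lie algebra.\<close>

definition lie_generated :: "(complex ^ 'n ^ 'n) set \<Rightarrow> (complex ^ 'n ^ 'n) set" where
  "lie_generated X =
     (\<lambda>L. subspace L \<and> (\<forall>A\<in>L. \<forall>B\<in>L. A ** B - B ** A \<in> L)) hull X"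

definition su :: "(complex ^ 'n ^ 'n) set" where
  "su = {A. antihermitian A \<and> trace A = 0}"

text \<open>
  The anti-Hermitian operators are taken from the complex span, not only from \<open>S\<close> itself.
\<close>

definition hoermander_system :: "(complex ^ 'n ^ 'n) set \<Rightarrow> bool" where
  "hoermander_system S \<longleftrightarrow> su \<subseteq> lie_generated {A \<in> cmat.span S. antihermitian A}"

text \<open>
  \<open>exp\<close> is not available here: \<open>*\<close> on \<open>complex ^ 'n ^ 'n\<close> is the entrywise product. \<open>lin_exp F\<close> is
  the exponential series of a linear map \<open>F\<close>, evaluated at a point; it serves both for operators
  (through left multiplication) and for maps on operators.
\<close>

definition lin_exp :: "('a::euclidean_space \<Rightarrow> 'a) \<Rightarrow> 'a \<Rightarrow> 'a" where
  "lin_exp F x = (\<Sum>k. (F ^^ k) x /\<^sub>R fact k)"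

lemma summable_lin_exp:
  fixes F :: "'a::euclidean_space \<Rightarrow> 'a"
  assumes "linear F"
  shows "summable (\<lambda>k. (F ^^ k) x /\<^sub>R fact k)"
proof -
  obtain K where K: "K > 0" "\<And>y. norm (F y) \<le> K * norm y"
    using linear_bounded_pos[OF assms] by auto
  have b: "norm ((F ^^ k) x) \<le> K ^ k * norm x" for k
  proof (induction k)
    case (Suc k)
    have "norm ((F ^^ Suc k) x) \<le> K * norm ((F ^^ k) x)"
      using K(2) by simp
    also have "\<dots> \<le> K * (K ^ k * norm x)"
      using Suc K(1) by (intro mult_left_mono) auto
    finally show ?case by (simp add: mult.assoc)
  qed simp
  have "summable (\<lambda>k. (K ^ k /\<^sub>R fact k) * norm x)"
    by (intro summable_mult2 summable_exp_generic)
  then show ?thesis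
  proof (rule summable_comparison_test')
    fix k :: nat
    show "norm ((F ^^ k) x /\<^sub>R fact k) \<le> (K ^ k /\<^sub>R fact k) * norm x"
      using mult_left_mono[OF b[of k], of "inverse (fact k)"] by (simp add: mult.assoc)
  qed
qed

definition mexp :: "complex ^ 'n ^ 'n \<Rightarrow> complex ^ 'n ^ 'n" where
  "mexp A = lin_exp (\<lambda>X. A ** X) (mat 1)"

definition lindblad :: "complex ^ 'n ^ 'n \<Rightarrow> complex ^ 'n ^ 'n \<Rightarrow> complex ^ 'n ^ 'n" where
  "lindblad a \<rho> = 2 *\<^sub>R (a ** \<rho> ** cadjoint a) - cadjoint a ** a ** \<rho> - \<rho> ** cadjoint a ** a"

lemma linear_lindblad: "linear (\<lambda>\<rho>. t *\<^sub>R lindblad (a :: complex ^ 'n ^ 'n) \<rho>)"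
proof -
  have 1: "A ** (r *\<^sub>R B) = r *\<^sub>R (A ** B)" "(r *\<^sub>R A) ** B = r *\<^sub>R (A ** B)"
    for r and A B :: "complex ^ 'n ^ 'n"
    by (simp_all add: vec_eq_iff matrix_matrix_mult_def scaleR_sum_right)
  have 2: "A ** (B + C) = A ** B + A ** C" "(A + B) ** C = A ** C + B ** C"
    for A B C :: "complex ^ 'n ^ 'n"
    by (simp_all add: vec_eq_iff matrix_matrix_mult_def distrib_left distrib_right sum.distrib)
  show ?thesis
    by (rule linearI)
      (simp_all add: lindblad_def 1 2 algebra_simps)
qed

inductive_set channels ::
  "(complex ^ 'n ^ 'n) set \<Rightarrow> (complex ^ 'n ^ 'n \<Rightarrow> complex ^ 'n ^ 'n) set"
  for S :: "(complex ^ 'n ^ 'n) set"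
  where
    UN: "\<lbrakk>cscale \<i> H \<in> cmat.span S; antihermitian (cscale \<i> H); 0 \<le> t\<rbrakk> \<Longrightarrow>
      (\<lambda>\<rho>. mexp (cscale (\<i> * complex_of_real t) H) ** \<rho> **
            mexp (cscale (- (\<i> * complex_of_real t)) H)) \<in> channels S"
  | JU: "\<lbrakk>a \<in> S; 0 \<le> t\<rbrakk> \<Longrightarrow> lin_exp (\<lambda>\<rho>. t *\<^sub>R lindblad a \<rho>) \<in> channels S"
  | CO: "\<lbrakk>\<Phi> \<in> channels S; \<Psi> \<in> channels S\<rbrakk> \<Longrightarrow> \<Phi> \<circ> \<Psi> \<in> channels S"

text \<open>
  The family \<open>T\<close> is any family indexed by \<open>t \<ge> 0\<close>; neither a semigroup law nor continuity in \<open>t\<close>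
  is required.
\<close>

definition transitive_on_states :: "(complex ^ 'n ^ 'n \<Rightarrow> complex ^ 'n ^ 'n) set \<Rightarrow> bool" where
  "transitive_on_states Op \<longleftrightarrow>
     (\<forall>\<rho>\<in>states. \<forall>\<sigma>\<in>states.
        (\<exists>\<Phi>\<in>Op. \<Phi> \<rho> = \<sigma>) \<or>
        (\<exists>T::real \<Rightarrow> _. (\<forall>t\<ge>0. T t \<in> Op) \<and>
           ((\<exists>\<tau>>0. T \<tau> \<rho> = \<sigma>) \<or> ((\<lambda>t. T t \<rho>) \<longlongrightarrow> \<sigma>) at_top)))"

end

theory Submission
  imports Defs
begin

text \<open>
  Conjugations in the class generate, after closure, a closed group \<open>G\<close> of unitaries. The
  generators \<open>A\<close> with \<open>exp (t A) \<in> G\<close> for all \<open>t\<close> form a real Lie algebra, so the Hoermander condition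
  puts all of \<open>su\<close> into it. A maximisation over \<open>G\<close> diagonalises every state in the given basis, and
  reflections \<open>1 - |i - j\<rangle>\<langle>i - j|\<close>, which are in \<open>G\<close> up to a phase, exchange basis vectors. On diagonal
  states, \<open>exp (t L\<^sub>a)\<close> moves a fraction \<open>1 - exp (- 2 t)\<close> of the mass at \<open>|1\<rangle>\<close> to \<open>|0\<rangle>\<close>; together with
  the exchanges, all mass can be collected at \<open>|0\<rangle>\<close> in the limit and then distributed arbitrarily.
  Channels are continuous, so limits may be composed.
\<close>

section \<open>Matrix algebra\<close>

lemma bounded_bilinear_matrix_mult:
  "bounded_bilinear ((**) :: complex ^ 'n ^ 'n \<Rightarrow> complex ^ 'n ^ 'n \<Rightarrow> complex ^ 'n ^ 'n)"
  by (simp flip: bilinear_conv_bounded_bilinear)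
    (auto simp: bilinear_def vec_eq_iff matrix_matrix_mult_def scaleR_sum_right distrib_left
      distrib_right sum.distrib intro!: linearI)

interpretation matrix_mult: bounded_bilinear
  "(**) :: complex ^ 'n ^ 'n \<Rightarrow> complex ^ 'n ^ 'n \<Rightarrow> complex ^ 'n ^ 'n"
  by (rule bounded_bilinear_matrix_mult)

lemma bounded_linear_cadjoint: "bounded_linear (cadjoint :: complex ^ 'n ^ 'n \<Rightarrow> _)"
  by (simp flip: linear_conv_bounded_linear)
    (auto simp: vec_eq_iff cadjoint_def intro!: linearI)

lemmas linear_cadjoint = bounded_linear.linear[OF bounded_linear_cadjoint]

lemmas cadjoint_simps =
  linear_add[OF linear_cadjoint]
  linear_diff[OF linear_cadjoint]
  linear_neg[OF linear_cadjoint]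
  linear_cmul[OF linear_cadjoint]
  linear_sum[OF linear_cadjoint]

lemma bounded_linear_trace: "bounded_linear (trace :: complex ^ 'n ^ 'n \<Rightarrow> complex)"
  by (simp flip: linear_conv_bounded_linear)
    (auto simp: trace_def sum.distrib scaleR_sum_right intro!: linearI)

lemmas linear_trace = bounded_linear.linear[OF bounded_linear_trace]

lemma cadjoint_cadjoint [simp]: "cadjoint (cadjoint A) = A"
  by (simp add: cadjoint_def vec_eq_iff)

lemma cadjoint_mult: "cadjoint (A ** B) = cadjoint B ** cadjoint A"
  by (simp add: cadjoint_def matrix_matrix_mult_def vec_eq_iff mult.commute)

lemma cadjoint_mat_1 [simp]: "cadjoint (mat 1) = mat 1"
  by (simp add: cadjoint_def mat_def vec_eq_iff)

lemma cadjoint_cscale: "cadjoint (cscale c A) = cscale (cnj c) (cadjoint A)"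
  by (simp add: cadjoint_def cscale_def vec_eq_iff)

lemma cadjoint_ketbra [simp]: "cadjoint (ketbra u v) = ketbra v u"
  by (simp add: cadjoint_def ketbra_def vec_eq_iff mult.commute)

lemma cscale_mult_left: "cscale c A ** B = cscale c (A ** B)"
  and cscale_mult_right: "A ** cscale c B = cscale c (A ** B)"
  by (simp_all add: cscale_def matrix_matrix_mult_def vec_eq_iff sum_distrib_left algebra_simps)

lemma cscale_of_real: "cscale (complex_of_real r) A = r *\<^sub>R A"
  by (simp add: cscale_def vec_eq_iff scaleR_conv_of_real[where 'a = complex])

lemma trace_cscale: "trace (cscale c A) = c * trace A"
  by (simp add: cscale_def trace_def sum_distrib_left)

lemma matrix_mult_ketbra: "A ** ketbra u v = ketbra (A *v u) v"
  by (simp add: ketbra_def matrix_matrix_mult_def matrix_vector_mult_def vec_eq_iff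
      sum_distrib_right mult.assoc)

lemma ketbra_matrix_mult: "ketbra u v ** A = ketbra u (cadjoint A *v v)"
  by (simp add: ketbra_def cadjoint_def matrix_matrix_mult_def matrix_vector_mult_def vec_eq_iff
      sum_distrib_left algebra_simps)

lemma ketbra_mult: "ketbra u v ** ketbra x y = cscale (cinner v x) (ketbra u y)"
  by (simp add: ketbra_def cscale_def cinner_def matrix_matrix_mult_def vec_eq_iff
      sum_distrib_left sum_distrib_right algebra_simps)

lemma trace_ketbra: "trace (ketbra u v) = cinner v u"
  by (simp add: trace_def ketbra_def cinner_def mult.commute)

lemma ketbra_vec: "ketbra u v *v x = cinner v x *s u"
  by (simp add: ketbra_def cinner_def matrix_vector_mult_def vec_eq_iff
      sum_distrib_left sum_distrib_right algebra_simps)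

lemma power2_norm_eq_trace: "complex_of_real ((norm A)\<^sup>2) = trace (cadjoint A ** A)"
  for A :: "complex ^ 'n ^ 'n"
proof -
  have "(norm A)\<^sup>2 = (\<Sum>i\<in>UNIV. \<Sum>j\<in>UNIV. (cmod (A $ i $ j))\<^sup>2)"
    by (simp add: norm_vec_def L2_set_def sum_nonneg)
  also have "complex_of_real \<dots> = (\<Sum>i\<in>UNIV. \<Sum>j\<in>UNIV. cnj (A $ i $ j) * A $ i $ j)"
    by (simp add: complex_norm_square[unfolded of_real_power] mult.commute)
  also have "\<dots> = trace (cadjoint A ** A)"
    unfolding trace_def cadjoint_def matrix_matrix_mult_def
    by (subst sum.swap) simp
  finally show ?thesis .
qed

section \<open>The exponential series\<close>

lemma funpow_scaleR:
  fixes F :: "'a::real_vector \<Rightarrow> 'a"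
  assumes "linear F"
  shows "((\<lambda>x. t *\<^sub>R F x) ^^ k) x = t ^ k *\<^sub>R (F ^^ k) x"
  by (induction k) (simp_all add: linear_cmul[OF assms])

lemma lin_exp_has_vector_derivative:
  fixes F :: "'a::euclidean_space \<Rightarrow> 'a"
  assumes F: "linear F"
  shows "((\<lambda>t. lin_exp (\<lambda>x. t *\<^sub>R F x) x) has_vector_derivative
           F (lin_exp (\<lambda>x. t *\<^sub>R F x) x)) (at t)"
proof -
  have lin: "linear (\<lambda>x. s *\<^sub>R F x)" for s
    using F by (rule linear_compose_scale_right)
  have sums: "(\<lambda>k. s ^ k *\<^sub>R (F ^^ k) x /\<^sub>R fact k) sums lin_exp (\<lambda>x. s *\<^sub>R F x) x" for s
    using summable_sums[OF summable_lin_exp[OF lin]] unfolding lin_exp_def funpow_scaleR[OF F] .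
  have deriv: "((\<lambda>t. lin_exp (\<lambda>x. t *\<^sub>R F x) x \<bullet> b) has_field_derivative
           F (lin_exp (\<lambda>x. t *\<^sub>R F x) x) \<bullet> b) (at t)" for b
  proof -
    define c where "c k = ((F ^^ k) x \<bullet> b) / fact k" for k
    have s: "(\<lambda>k. c k * s ^ k) sums (lin_exp (\<lambda>x. s *\<^sub>R F x) x \<bullet> b)" for s
      using bounded_linear.sums[OF bounded_linear_inner_left sums, of s b]
      by (simp add: c_def field_simps)
    have "(\<lambda>k. F (t ^ k *\<^sub>R (F ^^ k) x /\<^sub>R fact k) \<bullet> b) sums (F (lin_exp (\<lambda>x. t *\<^sub>R F x) x) \<bullet> b)"
      using bounded_linear.sums[OF bounded_linear_inner_left
        bounded_linear.sums[OF _ sums]] F linear_conv_bounded_linear by blast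
    moreover have "F (t ^ k *\<^sub>R (F ^^ k) x /\<^sub>R fact k) \<bullet> b = diffs c k * t ^ k" for k
      by (simp add: linear_cmul[OF F] diffs_def c_def divide_simps del: of_nat_Suc)
    ultimately have "(\<Sum>k. diffs c k * t ^ k) = F (lin_exp (\<lambda>x. t *\<^sub>R F x) x) \<bullet> b"
      by (simp add: sums_iff)
    moreover have "((\<lambda>t. \<Sum>k. c k * t ^ k) has_field_derivative (\<Sum>k. diffs c k * t ^ k)) (at t)"
      by (rule termdiffs_strong_converges_everywhere) (use s in \<open>auto simp: sums_iff\<close>)
    moreover have "(\<lambda>t. \<Sum>k. c k * t ^ k) = (\<lambda>t. lin_exp (\<lambda>x. t *\<^sub>R F x) x \<bullet> b)"
      using s by (auto simp: sums_iff)
    ultimately show ?thesis by simp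
  qed
  show ?thesis
    unfolding has_vector_derivative_def
    by (subst has_derivative_componentwise_within)
      (use deriv in \<open>auto simp: has_field_derivative_def mult_commute_abs\<close>)
qed

lemma linear_lin_exp:
  fixes F :: "'a::euclidean_space \<Rightarrow> 'a"
  assumes "linear F"
  shows "linear (lin_exp F)"
proof -
  have F: "linear (F ^^ k)" for k
    by (induction k) (auto simp: o_def linear_iff[of "\<lambda>a. a"] intro: linear_compose[OF _ assms, unfolded o_def])
  show ?thesis
    by (rule linearI)
      (simp_all add: lin_exp_def linear_add[OF F] linear_cmul[OF F] scaleR_right_distrib
        suminf_add summable_lin_exp[OF assms] mult.commute
        suminf_scaleR_right[OF summable_lin_exp[OF assms]])
qed

lemma lin_exp_eigenvector:
  fixes F :: "'a::euclidean_space \<Rightarrow> 'a"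
  assumes F: "linear F" and x: "F x = r *\<^sub>R x"
  shows "lin_exp F x = exp r *\<^sub>R x"
proof -
  have "(F ^^ k) x = r ^ k *\<^sub>R x" for k
    by (induction k) (simp_all add: linear_cmul[OF F] x)
  then have "(F ^^ k) x /\<^sub>R fact k = (r ^ k /\<^sub>R fact k) *\<^sub>R x" for k
    by simp
  then show ?thesis
    using suminf_scaleR_left[OF summable_exp_generic[of r], of x]
    by (simp add: lin_exp_def exp_def)
qed

definition unitary :: "complex ^ 'n ^ 'n \<Rightarrow> bool" where
  "unitary U \<longleftrightarrow> cadjoint U ** U = mat 1"

lemma unitary_left: "unitary U \<Longrightarrow> cadjoint U ** U = mat 1"
  by (simp add: unitary_def)

lemma unitary_right: "unitary U \<Longrightarrow> U ** cadjoint U = mat 1"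
  by (simp add: unitary_def matrix_left_right_inverse)

lemma unitary_mat_1 [simp]: "unitary (mat 1)"
  by (simp add: unitary_def)

lemma unitary_cadjoint: "unitary U \<Longrightarrow> unitary (cadjoint U)"
  using unitary_right by (simp add: unitary_def)

lemma unitary_mult: "unitary U \<Longrightarrow> unitary V \<Longrightarrow> unitary (U ** V)"
proof -
  assume U: "unitary U" and V: "unitary V"
  have "cadjoint (U ** V) ** (U ** V) = cadjoint V ** (cadjoint U ** U) ** V"
    by (simp only: cadjoint_mult matrix_mul_assoc)
  then show ?thesis
    using U V by (simp add: unitary_def)
qed

lemma norm_unitary_mult_left:
  fixes A :: "complex ^ 'n ^ 'n"
  assumes "unitary U"
  shows "norm (U ** A) = norm A"
proof -
  have "cadjoint (U ** A) ** (U ** A) = cadjoint A ** (cadjoint U ** U) ** A"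
    by (simp add: cadjoint_mult matrix_mul_assoc)
  then have "(norm (U ** A))\<^sup>2 = (norm A)\<^sup>2"
    using assms unfolding of_real_eq_iff[where 'a = complex, symmetric] power2_norm_eq_trace
    by (simp add: unitary_left)
  then show ?thesis by simp
qed

lemma norm_unitary_mult_right:
  fixes A :: "complex ^ 'n ^ 'n"
  assumes "unitary U"
  shows "norm (A ** U) = norm A"
proof -
  have "trace (cadjoint (A ** U) ** (A ** U)) = trace ((A ** U) ** (cadjoint U ** cadjoint A))"
    unfolding cadjoint_mult by (rule trace_mul_sym)
  also have "(A ** U) ** (cadjoint U ** cadjoint A) = A ** (U ** cadjoint U) ** cadjoint A"
    by (simp only: matrix_mul_assoc)
  also have "\<dots> = A ** cadjoint A"
    using assms by (simp add: unitary_right)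
  also have "trace (A ** cadjoint A) = trace (cadjoint A ** A)"
    by (rule trace_mul_sym)
  finally have "(norm (A ** U))\<^sup>2 = (norm A)\<^sup>2"
    by (simp flip: power2_norm_eq_trace of_real_power)
  then show ?thesis by simp
qed

lemma norm_unitary: "unitary U \<Longrightarrow> norm U = norm (mat 1 :: complex ^ 'n ^ 'n)"
  for U :: "complex ^ 'n ^ 'n"
  using norm_unitary_mult_left[of U "mat 1"] by simp

lemma linear_matrix_mult: "linear ((**) A :: complex ^ 'n ^ 'n \<Rightarrow> complex ^ 'n ^ 'n)"
  by (rule bounded_linear.linear) (rule matrix_mult.bounded_linear_right)

lemma mexp_has_vector_derivative:
  "((\<lambda>t. mexp (t *\<^sub>R A)) has_vector_derivative A ** mexp (t *\<^sub>R A)) (at t)"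
  unfolding mexp_def matrix_mult.scaleR_left
  by (rule lin_exp_has_vector_derivative) (rule linear_matrix_mult)

lemma mexp_0 [simp]: "mexp 0 = (mat 1 :: complex ^ 'n ^ 'n)"
  using lin_exp_eigenvector[OF linear_zero, where r = 0 and x = "mat 1 :: complex ^ 'n ^ 'n"]
  by (simp add: mexp_def)

lemma cadjoint_mexp_has_vector_derivative:
  assumes "antihermitian A"
  shows "((\<lambda>t. cadjoint (mexp (t *\<^sub>R A))) has_vector_derivative
    - (cadjoint (mexp (t *\<^sub>R A)) ** A)) (at t)"
  using bounded_linear.has_vector_derivative[OF bounded_linear_cadjoint
      mexp_has_vector_derivative[of A t]] assms
  by (simp add: cadjoint_mult antihermitian_def matrix_mult.minus_right)

lemma unitary_mexp:
  assumes "antihermitian A"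
  shows "unitary (mexp (t *\<^sub>R A))"
proof -
  define E where "E t = mexp (t *\<^sub>R A)" for t
  have E: "(E has_vector_derivative A ** E t) (at t)" for t
    unfolding E_def by (rule mexp_has_vector_derivative)
  have E': "((\<lambda>t. cadjoint (E t)) has_vector_derivative - (cadjoint (E t) ** A)) (at t)" for t
    unfolding E_def by (rule cadjoint_mexp_has_vector_derivative) (rule assms)
  have "((\<lambda>t. cadjoint (E t) ** E t) has_vector_derivative 0) (at t)" for t
    using matrix_mult.has_vector_derivative[OF E' E, of t]
    by (simp add: matrix_mul_assoc matrix_mult.minus_left)
  then obtain c where c: "cadjoint (E t) ** E t = c" for t
    using has_vector_derivative_zero_constant[of UNIV "\<lambda>t. cadjoint (E t) ** E t"] by auto
  show ?thesis
    using c[of t] c[of 0] by (simp add: unitary_def E_def)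
qed

lemma mexp_add:
  assumes "antihermitian A"
  shows "mexp ((s + t) *\<^sub>R A) = mexp (s *\<^sub>R A) ** mexp (t *\<^sub>R A)"
proof -
  define E where "E t = mexp (t *\<^sub>R A)" for t
  have E: "(E has_vector_derivative A ** E t) (at t)" for t
    unfolding E_def by (rule mexp_has_vector_derivative)
  have E': "((\<lambda>t. cadjoint (E t)) has_vector_derivative - (cadjoint (E t) ** A)) (at t)" for t
    unfolding E_def by (rule cadjoint_mexp_has_vector_derivative) (rule assms)
  have shift: "((\<lambda>s. E (s + t)) has_vector_derivative A ** E (s + t)) (at s)" for s
  proof -
    have "((\<lambda>s. s + t) has_vector_derivative 1) (at s)"
      by (auto intro!: derivative_eq_intros)
    then show ?thesis
      using vector_diff_chain_at[of "\<lambda>s. s + t" 1 s E, OF _ E] by (simp add: o_def)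
  qed
  have "((\<lambda>s. cadjoint (E s) ** E (s + t)) has_vector_derivative 0) (at s)" for s
    using matrix_mult.has_vector_derivative[OF E' shift, of s]
    by (simp add: matrix_mul_assoc matrix_mult.minus_left)
  then obtain c where c: "cadjoint (E s) ** E (s + t) = c" for s
    using has_vector_derivative_zero_constant[of UNIV "\<lambda>s. cadjoint (E s) ** E (s + t)"] by auto
  have "E (s + t) = E s ** cadjoint (E s) ** E (s + t)"
    unfolding E_def by (simp add: unitary_right unitary_mexp assms)
  also have "\<dots> = E s ** E t"
    using c[of s] c[of 0] by (simp add: E_def flip: matrix_mul_assoc)
  finally show ?thesis by (simp add: E_def)
qed

lemma cadjoint_mexp:
  assumes "antihermitian A"
  shows "cadjoint (mexp (t *\<^sub>R A)) = mexp ((- t) *\<^sub>R A)"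
proof -
  have "mat 1 = mexp (t *\<^sub>R A) ** mexp ((- t) *\<^sub>R A)"
    using mexp_add[OF assms, of t "- t"] by simp
  then have "cadjoint (mexp (t *\<^sub>R A)) ** mat 1 =
      cadjoint (mexp (t *\<^sub>R A)) ** mexp (t *\<^sub>R A) ** mexp ((- t) *\<^sub>R A)"
    by (simp only: matrix_mul_assoc)
  then show ?thesis
    by (simp add: unitary_left unitary_mexp assms)
qed

lemma mexp_difference_quotient:
  assumes "filterlim r (at 0) F"
  shows "((\<lambda>n. (mexp (r n *\<^sub>R A) - mat 1) /\<^sub>R r n) \<longlongrightarrow> A) F"
proof -
  have lim: "(\<lambda>h. norm (mexp (h *\<^sub>R A) - mat 1 - h *\<^sub>R A) / norm h) \<midarrow>0\<rightarrow> 0"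
    using mexp_has_vector_derivative[of A 0]
    by (simp add: has_vector_derivative_def has_derivative_at)
  have eq: "norm (mexp (h *\<^sub>R A) - mat 1 - h *\<^sub>R A) / norm h =
      norm ((mexp (h *\<^sub>R A) - mat 1) /\<^sub>R h - A)" if "h \<noteq> 0" for h
  proof -
    have "(mexp (h *\<^sub>R A) - mat 1) /\<^sub>R h - A = (mexp (h *\<^sub>R A) - mat 1 - h *\<^sub>R A) /\<^sub>R h"
      using that by (simp add: scaleR_diff_right)
    then show ?thesis by (simp add: divide_inverse mult.commute)
  qed
  have "(\<lambda>h. norm ((mexp (h *\<^sub>R A) - mat 1) /\<^sub>R h - A)) \<midarrow>0\<rightarrow> 0"
    by (rule LIM_equal[THEN iffD1, OF _ lim]) (intro allI impI eq)
  then have "((\<lambda>h. (mexp (h *\<^sub>R A) - mat 1) /\<^sub>R h) \<longlongrightarrow> A) (at 0)"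
    by (rule LIM_zero_cancel[OF tendsto_norm_zero_cancel])
  then show ?thesis
    using assms by (rule filterlim_compose)
qed

lemma tendsto_mexp_0:
  assumes "filterlim r (at 0) F"
  shows "((\<lambda>n. mexp (r n *\<^sub>R A)) \<longlongrightarrow> mat 1) F"
proof -
  have "isCont (\<lambda>t. mexp (t *\<^sub>R A)) 0"
    by (rule has_vector_derivative_continuous) (rule mexp_has_vector_derivative)
  moreover have "(r \<longlongrightarrow> 0) F"
    using assms by (simp add: filterlim_at)
  ultimately show ?thesis
    using isCont_tendsto_compose[of 0 "\<lambda>t. mexp (t *\<^sub>R A)" r F] by simp
qed

definition mpower :: "complex ^ 'n ^ 'n \<Rightarrow> nat \<Rightarrow> complex ^ 'n ^ 'n" where
  "mpower A k = ((**) A ^^ k) (mat 1)"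

lemma mpower_0 [simp]: "mpower A 0 = mat 1"
  and mpower_Suc: "mpower A (Suc k) = A ** mpower A k"
  by (simp_all add: mpower_def)

lemma mpower_mexp:
  assumes "antihermitian A"
  shows "mpower (mexp (s *\<^sub>R A)) k = mexp ((real k * s) *\<^sub>R A)"
proof (induction k)
  case (Suc k)
  have "real (Suc k) * s = s + real k * s"
    by (simp add: algebra_simps)
  then show ?case
    using Suc by (simp only: mpower_Suc mexp_add[OF assms])
qed simp

lemma unitary_mpower: "unitary U \<Longrightarrow> unitary (mpower U k)"
proof (induction k)
  case (Suc k)
  then show ?case
    unfolding mpower_Suc by (intro unitary_mult)
qed simp

lemma norm_mpower_diff_le:
  assumes U: "unitary U" and V: "unitary V"
  shows "norm (mpower U k - mpower V k) \<le> real k * norm (U - V)"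
proof (induction k)
  case 0
  show ?case by simp
next
  case (Suc k)
  have "mpower U (Suc k) - mpower V (Suc k) =
      U ** (mpower U k - mpower V k) + (U - V) ** mpower V k"
    unfolding mpower_Suc matrix_mult.diff_left matrix_mult.diff_right by simp
  then have "norm (mpower U (Suc k) - mpower V (Suc k)) \<le>
      norm (U ** (mpower U k - mpower V k)) + norm ((U - V) ** mpower V k)"
    by (metis norm_triangle_ineq)
  also have "\<dots> = norm (mpower U k - mpower V k) + norm (U - V)"
    by (simp only: norm_unitary_mult_left[OF U] norm_unitary_mult_right[OF unitary_mpower[OF V]])
  also have "\<dots> \<le> real (Suc k) * norm (U - V)"
    using Suc by (simp add: distrib_right)
  finally show ?case .
qed

section \<open>Closed groups of unitaries and their Lie algebras\<close>

definition closed_unitary_group :: "(complex ^ 'n ^ 'n) set \<Rightarrow> bool" where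
  "closed_unitary_group G \<longleftrightarrow> closed G \<and> mat 1 \<in> G \<and> (\<forall>U\<in>G. unitary U) \<and>
     (\<forall>U\<in>G. cadjoint U \<in> G) \<and> (\<forall>U\<in>G. \<forall>V\<in>G. U ** V \<in> G)"

lemma closed_unitary_groupD:
  assumes "closed_unitary_group G"
  shows "closed G" "mat 1 \<in> G" "\<And>U. U \<in> G \<Longrightarrow> unitary U" "\<And>U. U \<in> G \<Longrightarrow> cadjoint U \<in> G"
    "\<And>U V. U \<in> G \<Longrightarrow> V \<in> G \<Longrightarrow> U ** V \<in> G"
  using assms by (auto simp: closed_unitary_group_def)

text \<open>Telescoping gives \<open>g\<^sub>n\<^sup>n \<longlonglongrightarrow> exp A\<close>, because the Frobenius norm is unitarily invariant.\<close>

lemma mexp_in_closed_group: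
  assumes G: "closed_unitary_group G" and A: "antihermitian A"
    and g: "\<And>n. g n \<in> G" and lim: "(\<lambda>n. real (Suc n) *\<^sub>R (g n - mat 1)) \<longlonglongrightarrow> A"
  shows "mexp A \<in> G"
proof -
  define h where "h n = inverse (real (Suc n))" for n
  have h: "filterlim h (at 0) sequentially"
    unfolding filterlim_at h_def using LIMSEQ_inverse_real_of_nat by simp
  have pow: "mpower (g n) k \<in> G" for n k
    by (induction k) (simp_all add: mpower_Suc closed_unitary_groupD[OF G] g)
  have "(\<lambda>n. real (Suc n) *\<^sub>R (g n - mexp (h n *\<^sub>R A))) \<longlonglongrightarrow> 0"
    using tendsto_diff[OF lim mexp_difference_quotient[OF h, of A]]
    by (simp add: h_def scaleR_diff_right del: of_nat_Suc)
  then have "(\<lambda>n. norm (real (Suc n) *\<^sub>R (g n - mexp (h n *\<^sub>R A)))) \<longlonglongrightarrow> 0"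
    by (rule tendsto_norm_zero)
  then have "(\<lambda>n. mpower (g n) (Suc n) - mexp A) \<longlonglongrightarrow> 0"
  proof (rule Lim_null_comparison[rotated], intro always_eventually allI)
    fix n
    have "mpower (mexp (h n *\<^sub>R A)) (Suc n) = mexp A"
      by (simp add: mpower_mexp[OF A] h_def del: of_nat_Suc)
    then show "norm (mpower (g n) (Suc n) - mexp A) \<le>
        norm (real (Suc n) *\<^sub>R (g n - mexp (h n *\<^sub>R A)))"
      using norm_mpower_diff_le[of "g n" "mexp (h n *\<^sub>R A)" "Suc n"]
        closed_unitary_groupD(3)[OF G g[of n]] unitary_mexp[OF A]
      by simp
  qed
  then have "(\<lambda>n. mpower (g n) (Suc n)) \<longlonglongrightarrow> mexp A"
    by (rule LIM_zero_cancel)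
  then show ?thesis
    by (rule closed_sequentially[OF closed_unitary_groupD(1)[OF G] pow])
qed

definition tangent_algebra :: "(complex ^ 'n ^ 'n) set \<Rightarrow> (complex ^ 'n ^ 'n) set" where
  "tangent_algebra G = {A. antihermitian A \<and> (\<forall>t. mexp (t *\<^sub>R A) \<in> G)}"

lemma antihermitian_scaleR: "antihermitian A \<Longrightarrow> antihermitian (t *\<^sub>R A)"
  and antihermitian_add: "antihermitian A \<Longrightarrow> antihermitian B \<Longrightarrow> antihermitian (A + B)"
  and antihermitian_commutator:
    "antihermitian A \<Longrightarrow> antihermitian B \<Longrightarrow> antihermitian (A ** B - B ** A)"
  by (simp_all add: antihermitian_def cadjoint_simps cadjoint_mult matrix_mult.minus_left
      matrix_mult.minus_right)

lemma mexp_add_in_closed_group: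
  assumes G: "closed_unitary_group G" and A: "A \<in> tangent_algebra G" and B: "B \<in> tangent_algebra G"
  shows "mexp (A + B) \<in> G"
proof (rule mexp_in_closed_group[OF G])
  define h where "h n = inverse (real (Suc n))" for n
  have h: "filterlim h (at 0) sequentially"
    unfolding filterlim_at h_def using LIMSEQ_inverse_real_of_nat by simp
  define x where "x n = mexp (h n *\<^sub>R A)" for n
  define y where "y n = mexp (h n *\<^sub>R B)" for n
  show "x n ** y n \<in> G" for n
    using A B closed_unitary_groupD(5)[OF G] by (auto simp: tangent_algebra_def x_def y_def)
  have "(\<lambda>n. ((x n - mat 1) /\<^sub>R h n) ** y n + (y n - mat 1) /\<^sub>R h n) \<longlonglongrightarrow> A ** mat 1 + B"
    unfolding x_def y_def
    by (intro tendsto_add matrix_mult.tendsto mexp_difference_quotient tendsto_mexp_0 h)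
  then show "(\<lambda>n. real (Suc n) *\<^sub>R (x n ** y n - mat 1)) \<longlonglongrightarrow> A + B"
    by (simp add: h_def matrix_mult.diff_left matrix_mult.scaleR_left scaleR_diff_right del: of_nat_Suc)
qed (use A B in \<open>auto simp: tangent_algebra_def antihermitian_add\<close>)

lemma mexp_commutator_in_closed_group:
  assumes G: "closed_unitary_group G" and A: "A \<in> tangent_algebra G" and B: "B \<in> tangent_algebra G"
  shows "mexp (A ** B - B ** A) \<in> G"
proof (rule mexp_in_closed_group[OF G])
  define h where "h n = sqrt (inverse (real (Suc n)))" for n
  have "h \<longlonglongrightarrow> sqrt 0"
    unfolding h_def by (intro tendsto_real_sqrt LIMSEQ_inverse_real_of_nat)
  then have h: "filterlim h (at 0) sequentially"
    unfolding filterlim_at by (simp add: h_def)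
  have hh: "real (Suc n) = inverse (h n) * inverse (h n)" for n
    by (simp add: h_def flip: inverse_mult_distrib)
  define x where "x n = mexp (h n *\<^sub>R A)" for n
  define y where "y n = mexp (h n *\<^sub>R B)" for n
  have x: "x n \<in> G" "unitary (x n)" and y: "y n \<in> G" "unitary (y n)" for n
    using A B closed_unitary_groupD(3)[OF G] by (auto simp: tangent_algebra_def x_def y_def)
  \<comment> \<open>\<open>x y x\<^sup>* y\<^sup>* - 1 = [x - 1, y - 1] x\<^sup>* y\<^sup>*\<close>, and each factor of the commutator is of order \<open>1 / sqrt n\<close>.\<close>
  show "x n ** y n ** (cadjoint (x n) ** cadjoint (y n)) \<in> G" for n
    using x y by (intro closed_unitary_groupD[OF G])
  have "y n ** x n ** (cadjoint (x n) ** cadjoint (y n)) = mat 1" for n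
  proof -
    have "y n ** x n ** (cadjoint (x n) ** cadjoint (y n)) =
        y n ** (x n ** cadjoint (x n)) ** cadjoint (y n)"
      by (simp add: matrix_mul_assoc)
    then show ?thesis by (simp add: unitary_right x y)
  qed
  then have "real (Suc n) *\<^sub>R (x n ** y n ** (cadjoint (x n) ** cadjoint (y n)) - mat 1) =
      real (Suc n) *\<^sub>R (((x n - mat 1) ** (y n - mat 1) - (y n - mat 1) ** (x n - mat 1)) **
      (cadjoint (x n) ** cadjoint (y n)))" for n
    by (simp add: matrix_mult.diff_left matrix_mult.diff_right)
  also have "\<dots> n = (((x n - mat 1) /\<^sub>R h n) ** ((y n - mat 1) /\<^sub>R h n) -
      ((y n - mat 1) /\<^sub>R h n) ** ((x n - mat 1) /\<^sub>R h n)) ** (cadjoint (x n) ** cadjoint (y n))" for n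
    by (simp only: hh matrix_mult.scaleR_left matrix_mult.scaleR_right scaleR_scaleR
        flip: scaleR_diff_right)
  finally have eq: "real (Suc n) *\<^sub>R (x n ** y n ** (cadjoint (x n) ** cadjoint (y n)) - mat 1) =
      (((x n - mat 1) /\<^sub>R h n) ** ((y n - mat 1) /\<^sub>R h n) -
      ((y n - mat 1) /\<^sub>R h n) ** ((x n - mat 1) /\<^sub>R h n)) ** (cadjoint (x n) ** cadjoint (y n))" for n .
  have "(\<lambda>n. (((x n - mat 1) /\<^sub>R h n) ** ((y n - mat 1) /\<^sub>R h n) -
      ((y n - mat 1) /\<^sub>R h n) ** ((x n - mat 1) /\<^sub>R h n)) ** (cadjoint (x n) ** cadjoint (y n)))
      \<longlonglongrightarrow> (A ** B - B ** A) ** (cadjoint (mat 1) ** cadjoint (mat 1))"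
    unfolding x_def y_def
    by (intro tendsto_diff matrix_mult.tendsto bounded_linear.tendsto[OF bounded_linear_cadjoint]
        mexp_difference_quotient tendsto_mexp_0 h)
  then show "(\<lambda>n. real (Suc n) *\<^sub>R (x n ** y n ** (cadjoint (x n) ** cadjoint (y n)) - mat 1))
      \<longlonglongrightarrow> A ** B - B ** A"
    unfolding eq by simp
qed (use A B in \<open>auto simp: tangent_algebra_def antihermitian_commutator\<close>)

lemma tangent_algebra_scaleR: "A \<in> tangent_algebra G \<Longrightarrow> t *\<^sub>R A \<in> tangent_algebra G"
  by (auto simp: tangent_algebra_def antihermitian_scaleR)

lemma tangent_algebra_lie_closed:
  assumes "closed_unitary_group G" and "X \<subseteq> tangent_algebra G"
  shows "lie_generated X \<subseteq> tangent_algebra G"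
  unfolding lie_generated_def
proof (rule hull_minimal, fact, intro conjI ballI)
  have add: "A + B \<in> tangent_algebra G" if "A \<in> tangent_algebra G" "B \<in> tangent_algebra G" for A B
  proof -
    have "mexp (t *\<^sub>R A + t *\<^sub>R B) \<in> G" for t
      using that by (intro mexp_add_in_closed_group assms tangent_algebra_scaleR)
    then show ?thesis
      using that by (auto simp: tangent_algebra_def antihermitian_add scaleR_add_right)
  qed
  moreover have "0 \<in> tangent_algebra G"
    using closed_unitary_groupD(2)[OF assms(1)]
    by (auto simp: tangent_algebra_def antihermitian_def cadjoint_def vec_eq_iff)
  ultimately show "subspace (tangent_algebra G)"
    by (auto simp: subspace_def tangent_algebra_scaleR)
next
  fix A B assume AB: "A \<in> tangent_algebra G" "B \<in> tangent_algebra G"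
  have "mexp ((t *\<^sub>R A) ** B - B ** (t *\<^sub>R A)) \<in> G" for t
    using AB by (intro mexp_commutator_in_closed_group assms tangent_algebra_scaleR)
  then show "A ** B - B ** A \<in> tangent_algebra G"
    using AB by (auto simp: tangent_algebra_def antihermitian_commutator matrix_mult.scaleR_left
        matrix_mult.scaleR_right scaleR_diff_right)
qed

definition conj_by :: "complex ^ 'n ^ 'n \<Rightarrow> complex ^ 'n ^ 'n \<Rightarrow> complex ^ 'n ^ 'n" where
  "conj_by U \<rho> = U ** \<rho> ** cadjoint U"

lemma conj_by_mat_1 [simp]: "conj_by (mat 1) \<rho> = \<rho>"
  by (simp add: conj_by_def)

lemma conj_by_conj_by: "conj_by U (conj_by V \<rho>) = conj_by (U ** V) \<rho>"
  by (simp add: conj_by_def cadjoint_mult matrix_mul_assoc)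

lemma cadjoint_conj_by: "cadjoint (conj_by U \<rho>) = conj_by U (cadjoint \<rho>)"
  by (simp add: conj_by_def cadjoint_mult matrix_mul_assoc)

lemma trace_conj_by:
  assumes "unitary U"
  shows "trace (conj_by U \<rho>) = trace \<rho>"
proof -
  have "trace (conj_by U \<rho>) = trace (cadjoint U ** (U ** \<rho>))"
    unfolding conj_by_def by (rule trace_mul_sym)
  also have "\<dots> = trace \<rho>"
    using assms by (simp add: matrix_mul_assoc unitary_left)
  finally show ?thesis .
qed

lemma conj_by_ketbra: "conj_by U (ketbra u v) = ketbra (U *v u) (U *v v)"
  by (simp add: conj_by_def matrix_mult_ketbra ketbra_matrix_mult)

lemma linear_conj_by: "linear (conj_by U)"
  unfolding conj_by_def
  by (rule linearI) (simp_all add: matrix_mult.add_left matrix_mult.add_right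
      matrix_mult.scaleR_left matrix_mult.scaleR_right)

lemma conj_by_cscale: "conj_by (cscale c U) \<rho> = cscale (c * cnj c) (conj_by U \<rho>)"
  by (simp add: conj_by_def cadjoint_cscale cscale_mult_left cscale_mult_right mult.commute)

lemma continuous_on_cadjoint [continuous_intros]:
  "continuous_on T f \<Longrightarrow> continuous_on T (\<lambda>x. cadjoint (f x))"
  by (rule bounded_linear.continuous_on[OF bounded_linear_cadjoint])

lemma continuous_on_conj_by [continuous_intros]:
  "continuous_on T f \<Longrightarrow> continuous_on T g \<Longrightarrow> continuous_on T (\<lambda>x. conj_by (f x) (g x))"
  unfolding conj_by_def by (intro matrix_mult.continuous_on continuous_intros)

text \<open>
  At a maximiser \<open>U\<close> of \<open>Re (tr (C U \<rho> U\<^sup>*))\<close> over the compact group, put \<open>D = U \<rho> U\<^sup>*\<close>. The derivative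
  in the direction \<open>X = D C - C D\<close>, which lies in \<open>su\<close>, is \<open>tr (X X) = - (norm X)\<^sup>2\<close>.
\<close>

lemma critical_point_commutes:
  fixes G :: "(complex ^ 'n ^ 'n) set"
  assumes G: "closed_unitary_group G" and su: "su \<subseteq> tangent_algebra G"
    and C: "cadjoint C = C" and \<rho>: "cadjoint \<rho> = \<rho>"
  shows "\<exists>U\<in>G. C ** conj_by U \<rho> = conj_by U \<rho> ** C"
proof -
  have "norm U \<le> norm (mat 1 :: complex ^ 'n ^ 'n)" if "U \<in> G" for U
    using norm_unitary[OF closed_unitary_groupD(3)[OF G that]] by simp
  then have "G \<subseteq> cball 0 (norm (mat 1 :: complex ^ 'n ^ 'n))"
    by auto
  then have "compact G"
    using closed_unitary_groupD(1)[OF G] bounded_subset[OF bounded_cball]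
    by (simp add: compact_eq_bounded_closed)
  moreover have "continuous_on G (\<lambda>U. Re (trace (C ** conj_by U \<rho>)))"
    by (intro continuous_intros matrix_mult.continuous_on
        bounded_linear.continuous_on[OF bounded_linear_trace])
  moreover have "G \<noteq> {}"
    using closed_unitary_groupD(2)[OF G] by blast
  ultimately obtain U where U: "U \<in> G"
    and max: "\<And>V. V \<in> G \<Longrightarrow> Re (trace (C ** conj_by V \<rho>)) \<le> Re (trace (C ** conj_by U \<rho>))"
    using continuous_attains_sup[of G "\<lambda>U. Re (trace (C ** conj_by U \<rho>))"] by blast
  define D where "D = conj_by U \<rho>"
  define X where "X = D ** C - C ** D"
  have D: "cadjoint D = D"
    by (simp add: D_def cadjoint_conj_by \<rho>)
  have X: "cadjoint X = - X"
    by (simp add: X_def cadjoint_simps cadjoint_mult C D)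
  have "trace X = 0"
    unfolding X_def linear_diff[OF linear_trace]
    by (simp add: trace_mul_sym[of D])
  then have "X \<in> tangent_algebra G"
    using su X by (auto simp: su_def antihermitian_def)
  then have E: "mexp (t *\<^sub>R X) \<in> G" for t
    by (simp add: tangent_algebra_def)
  define h where "h t = Re (trace (C ** conj_by (mexp (t *\<^sub>R X)) D))" for t
  have d: "((\<lambda>t. mexp (t *\<^sub>R X)) has_vector_derivative X) (at 0)"
    using mexp_has_vector_derivative[of X 0] by simp
  have "((\<lambda>t. cadjoint (mexp (t *\<^sub>R X))) has_vector_derivative - X) (at 0)"
    using bounded_linear.has_vector_derivative[OF bounded_linear_cadjoint d] by (simp add: X)
  from matrix_mult.has_vector_derivative[OF matrix_mult.has_vector_derivative
      [OF d has_vector_derivative_const] this]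
  have "((\<lambda>t. conj_by (mexp (t *\<^sub>R X)) D) has_vector_derivative X ** D - D ** X) (at 0)"
    by (simp add: conj_by_def[abs_def] matrix_mult.minus_right matrix_mult.zero_right)
  from bounded_linear.has_vector_derivative[OF bounded_linear_Re
      bounded_linear.has_vector_derivative[OF bounded_linear_trace
      matrix_mult.has_vector_derivative[OF has_vector_derivative_const this]]]
  have "(h has_vector_derivative Re (trace (C ** (X ** D - D ** X)))) (at 0)"
    by (simp add: h_def[abs_def] matrix_mult.zero_left)
  then have deriv: "DERIV h 0 :> Re (trace (C ** (X ** D - D ** X)))"
    by (simp add: has_real_derivative_iff_has_vector_derivative)
  have "h t \<le> h 0" for t
    using max[of "mexp (t *\<^sub>R X) ** U"] E[of t] closed_unitary_groupD(5)[OF G _ U]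
    by (simp add: h_def D_def conj_by_conj_by)
  then have "Re (trace (C ** (X ** D - D ** X))) = 0"
    using DERIV_local_max[OF deriv, of 1] by simp
  also have "trace (C ** (X ** D - D ** X)) = trace (X ** (D ** C)) - trace (X ** (C ** D))"
    unfolding matrix_mult.diff_right linear_diff[OF linear_trace]
    using trace_mul_sym[of C "X ** D"] trace_mul_sym[of "C ** D" X]
    by (simp add: matrix_mul_assoc)
  also have "\<dots> = trace (X ** X)"
    unfolding X_def matrix_mult.diff_right linear_diff[OF linear_trace] ..
  also have "\<dots> = - trace (cadjoint X ** X)"
    by (simp add: X matrix_mult.minus_left
        linear_neg[OF linear_trace])
  also have "\<dots> = - complex_of_real ((norm X)\<^sup>2)"
    by (simp only: power2_norm_eq_trace)
  finally have "X = 0"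
    by simp
  then show ?thesis
    using U by (intro bexI[of _ U]) (simp_all add: X_def D_def)
qed

lemma lin_exp_mult_eigenvector:
  fixes A X :: "complex ^ 'n ^ 'n"
  assumes "A ** X = cscale c X"
  shows "lin_exp ((**) A) X = cscale (exp c) X"
proof -
  have "bounded_linear (\<lambda>c. cscale c X)"
    by (simp flip: linear_conv_bounded_linear)
      (auto simp: vec_eq_iff cscale_def distrib_right intro!: linearI)
  moreover have "(\<lambda>k. c ^ k /\<^sub>R fact k) sums exp c"
    by (rule exp_converges)
  ultimately have "(\<lambda>k. cscale (c ^ k /\<^sub>R fact k) X) sums cscale (exp c) X"
    by (rule bounded_linear.sums)
  moreover have "((**) A ^^ k) X = cscale (c ^ k) X" for k
    by (induction k) (simp_all add: cscale_mult_right assms mult.commute)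
  then have "((**) A ^^ k) X /\<^sub>R fact k = cscale (c ^ k /\<^sub>R fact k) X" for k
    by (simp add: vec_eq_iff cscale_def)
  ultimately show ?thesis
    by (simp add: lin_exp_def sums_iff)
qed

lemma reflection_in_group:
  fixes G :: "(complex ^ 'n ^ 'n) set" and P :: "complex ^ 'n ^ 'n"
  assumes su: "su \<subseteq> tangent_algebra G"
    and P: "P ** P = P" "cadjoint P = P" "trace P = 1"
  shows "\<exists>U\<in>G. conj_by U = conj_by (mat 1 - 2 *\<^sub>R P)"
proof -
  define n where "n = real CARD('n)"
  have n: "n > 0"
    by (simp add: n_def)
  \<comment> \<open>Subtracting \<open>1 / n\<close> puts the generator of the reflection into \<open>su\<close>, at the cost of a global phase.\<close>
  define A where "A = cscale (\<i> * pi) (P - (1 / n) *\<^sub>R mat 1)"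
  define \<mu> where "\<mu> = - (\<i> * of_real (pi / n))"
  have tr1: "trace (mat 1 :: complex ^ 'n ^ 'n) = of_real n"
    by (simp add: trace_def mat_def n_def)
  have "trace A = 0"
    using n by (simp add: A_def trace_cscale linear_diff[OF linear_trace]
        linear_cmul[OF linear_trace] P tr1 scaleR_conv_of_real[where 'a = complex])
  moreover have "cadjoint A = - A"
    by (simp add: A_def cadjoint_cscale cadjoint_simps P)
  ultimately have "A \<in> su"
    by (simp add: su_def antihermitian_def)
  then have "mexp (1 *\<^sub>R A) \<in> G"
    using su unfolding tangent_algebra_def by blast
  then have A: "mexp A \<in> G"
    by simp
  have "A ** P = cscale (\<i> * pi + \<mu>) P"
    by (simp add: A_def \<mu>_def cscale_mult_left matrix_mult.diff_left matrix_mult.scaleR_left P)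
      (simp add: cscale_def vec_eq_iff algebra_simps scaleR_conv_of_real[where 'a = complex])
  then have "lin_exp ((**) A) P = cscale (exp (\<i> * pi + \<mu>)) P"
    by (rule lin_exp_mult_eigenvector)
  then have e1: "lin_exp ((**) A) P = - cscale (exp \<mu>) P"
    by (simp add: exp_add exp_pi_i' cscale_def vec_eq_iff)
  have "A ** (mat 1 - P) = cscale \<mu> (mat 1 - P)"
    by (simp add: A_def \<mu>_def cscale_mult_left matrix_mult.diff_left matrix_mult.diff_right
        matrix_mult.scaleR_left P)
      (simp add: cscale_def vec_eq_iff algebra_simps scaleR_conv_of_real[where 'a = complex])
  then have e2: "lin_exp ((**) A) (mat 1 - P) = cscale (exp \<mu>) (mat 1 - P)"
    by (rule lin_exp_mult_eigenvector)
  have "mexp A = lin_exp ((**) A) P + lin_exp ((**) A) (mat 1 - P)"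
    using linear_add[OF linear_lin_exp[OF linear_matrix_mult], of A P "mat 1 - P"]
    by (simp add: mexp_def)
  also have "\<dots> = cscale (exp \<mu>) (mat 1 - 2 *\<^sub>R P)"
    unfolding e1 e2
    by (simp add: cscale_def vec_eq_iff algebra_simps scaleR_conv_of_real[where 'a = complex])
  finally have "conj_by (mexp A) = conj_by (mat 1 - 2 *\<^sub>R P)"
    by (simp add: fun_eq_iff conj_by_cscale \<mu>_def exp_cnj flip: exp_add)
  then show ?thesis
    using A by blast
qed

section \<open>Reachability\<close>

definition reach :: "(complex ^ 'n ^ 'n) set \<Rightarrow> complex ^ 'n ^ 'n \<Rightarrow> (complex ^ 'n ^ 'n) set" where
  "reach S \<rho> = closure ((\<lambda>\<Phi>. \<Phi> \<rho>) ` channels S)"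

lemma closed_reach: "closed (reach S \<rho>)"
  by (simp add: reach_def)

lemma reach_channel: "\<Phi> \<in> channels S \<Longrightarrow> \<Phi> \<rho> \<in> reach S \<rho>"
  unfolding reach_def by (intro subsetD[OF closure_subset] imageI)

lemma channels_continuous: "\<Phi> \<in> channels S \<Longrightarrow> continuous_on UNIV \<Phi>"
proof (induction rule: channels.induct)
  case (UN H t)
  show ?case
    by (intro matrix_mult.continuous_on continuous_intros)
next
  case (JU a t)
  have "bounded_linear (lin_exp (\<lambda>\<rho>. t *\<^sub>R lindblad a \<rho>))"
    using linear_lin_exp[OF linear_lindblad] linear_conv_bounded_linear by blast
  then show ?case
    by (rule linear_continuous_on)
next
  case (CO \<Phi> \<Psi>)
  then show ?case
    by (intro continuous_on_compose) (auto intro: continuous_on_subset)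
qed

lemma reach_trans:
  assumes "\<sigma> \<in> reach S \<rho>" "\<tau> \<in> reach S \<sigma>"
  shows "\<tau> \<in> reach S \<rho>"
proof -
  have "\<Phi> ` reach S \<rho> \<subseteq> reach S \<rho>" if "\<Phi> \<in> channels S" for \<Phi>
  proof -
    have "\<Phi> (\<Psi> \<rho>) \<in> reach S \<rho>" if "\<Psi> \<in> channels S" for \<Psi>
      using reach_channel[OF channels.CO[OF \<open>\<Phi> \<in> _\<close> that], of \<rho>] by simp
    then show ?thesis
      unfolding reach_def[of S \<rho>]
      by (intro image_closure_subset continuous_on_subset[OF channels_continuous[OF that]])
        (auto simp: closed_reach simp flip: reach_def)
  qed
  then have "(\<lambda>\<Phi>. \<Phi> \<sigma>) ` channels S \<subseteq> reach S \<rho>"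
    using assms(1) by blast
  then show ?thesis
    using assms(2) closure_minimal[OF _ closed_reach] unfolding reach_def[of S \<sigma>] by blast
qed

definition implementable :: "(complex ^ 'n ^ 'n) set \<Rightarrow> (complex ^ 'n ^ 'n) set" where
  "implementable S = {U. unitary U \<and> conj_by U \<in> channels S \<and> conj_by (cadjoint U) \<in> channels S}"

lemma conj_by_mexp_in_channels:
  assumes "A \<in> cmat.span S" "antihermitian A" "0 \<le> t"
  shows "conj_by (mexp (t *\<^sub>R A)) \<in> channels S"
proof -
  define H where "H = cscale (- \<i>) A"
  have H: "cscale \<i> H = A" "cscale (\<i> * complex_of_real t) H = t *\<^sub>R A"
      "cscale (- (\<i> * complex_of_real t)) H = (- t) *\<^sub>R A"
    by (simp_all add: H_def cscale_def vec_eq_iff algebra_simps scaleR_conv_of_real[where 'a = complex])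
  have "(\<lambda>\<rho>. mexp (cscale (\<i> * complex_of_real t) H) ** \<rho> **
      mexp (cscale (- (\<i> * complex_of_real t)) H)) \<in> channels S"
    using assms by (intro channels.UN) (simp_all add: H)
  then show ?thesis
    unfolding conj_by_def[abs_def] cadjoint_mexp[OF assms(2)] by (simp add: H)
qed

lemma mexp_implementable:
  assumes "A \<in> cmat.span S" "antihermitian A"
  shows "mexp (t *\<^sub>R A) \<in> implementable S"
proof -
  have "- A \<in> cmat.span S" "antihermitian (- A)"
    using assms cmat.span_neg by (auto simp: antihermitian_def cadjoint_simps)
  then have "conj_by (mexp (s *\<^sub>R A)) \<in> channels S" for s
    using conj_by_mexp_in_channels[of A S s] conj_by_mexp_in_channels[of "- A" S "- s"] assms
    by (cases "0 \<le> s") auto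
  then show ?thesis
    by (simp only: implementable_def mem_Collect_eq unitary_mexp[OF assms(2)]
        cadjoint_mexp[OF assms(2)])
qed

lemma implementable_mult:
  assumes "U \<in> implementable S" "V \<in> implementable S"
  shows "U ** V \<in> implementable S"
proof -
  have "conj_by (U ** V) = conj_by U \<circ> conj_by V"
      "conj_by (cadjoint (U ** V)) = conj_by (cadjoint V) \<circ> conj_by (cadjoint U)"
    by (simp_all add: fun_eq_iff conj_by_conj_by cadjoint_mult)
  then show ?thesis
    using assms by (auto simp: implementable_def unitary_mult intro: channels.CO)
qed

lemma closed_unitary_group_implementable: "closed_unitary_group (closure (implementable S))"
  unfolding closed_unitary_group_def
proof (intro conjI ballI)
  have "0 \<in> cmat.span S" "antihermitian 0"
    by (auto simp: cmat.span_zero antihermitian_def cadjoint_def vec_eq_iff)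
  then have "mat 1 \<in> implementable S"
    using mexp_implementable[of 0 S 0] by simp
  then show "mat 1 \<in> closure (implementable S)"
    using closure_subset by blast
next
  have "closed {U :: complex ^ 'n ^ 'n. unitary U}"
    unfolding unitary_def
    by (intro closed_Collect_eq matrix_mult.continuous_on continuous_intros)
  moreover have "implementable S \<subseteq> {U. unitary U}"
    by (auto simp: implementable_def)
  ultimately show "unitary U" if "U \<in> closure (implementable S)" for U
    using that closure_minimal by blast
next
  have "cadjoint ` closure (implementable S) \<subseteq> closure (implementable S)"
    using closure_subset[of "implementable S"]
    by (intro image_closure_subset continuous_intros)
      (auto simp: implementable_def unitary_cadjoint)
  then show "cadjoint U \<in> closure (implementable S)" if "U \<in> closure (implementable S)" for U
    using that by blast
next
  fix U V assume "U \<in> closure (implementable S)" "V \<in> closure (implementable S)"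
  then obtain u v where "\<And>n. u n \<in> implementable S" "u \<longlonglongrightarrow> U" "\<And>n. v n \<in> implementable S" "v \<longlonglongrightarrow> V"
    unfolding closure_sequential by blast
  then have "\<forall>n. u n ** v n \<in> implementable S" "(\<lambda>n. u n ** v n) \<longlonglongrightarrow> U ** V"
    by (auto intro: implementable_mult matrix_mult.tendsto)
  then show "U ** V \<in> closure (implementable S)"
    unfolding closure_sequential by (intro exI conjI)
qed simp

lemma reach_conj_by:
  assumes "U \<in> closure (implementable S)"
  shows "conj_by U \<rho> \<in> reach S \<rho>"
proof -
  have "(\<lambda>U. conj_by U \<rho>) ` closure (implementable S) \<subseteq> reach S \<rho>"
    by (intro image_closure_subset continuous_intros closed_reach)
      (auto simp: implementable_def intro: reach_channel)
  then show ?thesis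
    using assms by blast
qed

lemma su_subset_tangent_algebra:
  assumes "hoermander_system (cmat.span S)"
  shows "su \<subseteq> tangent_algebra (closure (implementable S))"
proof -
  have "{A \<in> cmat.span (cmat.span S). antihermitian A} \<subseteq> tangent_algebra (closure (implementable S))"
    using mexp_implementable[of _ S] closure_subset[of "implementable S"]
    by (auto simp: tangent_algebra_def cmat.span_span)
  from tangent_algebra_lie_closed[OF closed_unitary_group_implementable this] show ?thesis
    using assms unfolding hoermander_system_def by blast
qed

lemma cinner_diff_left: "cinner (u - v) x = cinner u x - cinner v x"
  and cinner_diff_right: "cinner x (u - v) = cinner x u - cinner x v"
  by (simp_all add: cinner_def algebra_simps sum_subtractf)

lemma inner_eq_Re_cinner: "u \<bullet> v = Re (cinner u v)" for u v :: "complex ^ 'n"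
  by (simp add: inner_vec_def cinner_def inner_complex_def)

lemma orthonormal_basisD:
  assumes "orthonormal_basis B"
  shows "u \<in> B \<Longrightarrow> v \<in> B \<Longrightarrow> cinner u v = (if u = v then 1 else 0)" "vec.span B = UNIV"
  using assms by (auto simp: orthonormal_basis_def)

lemma finite_orthonormal_basis: "orthonormal_basis B \<Longrightarrow> finite B"
  by (intro pairwise_orthogonal_imp_finite)
    (auto simp: pairwise_def orthogonal_def inner_eq_Re_cinner orthonormal_basisD)

lemma matrix_vector_mult_sum_left: "sum f I *v x = (\<Sum>i\<in>I. f i *v x)"
  by (induction I rule: infinite_finite_induct) (simp_all add: matrix_vector_mult_add_rdistrib)

lemma sum_ketbra_orthonormal_basis:
  assumes "orthonormal_basis B"
  shows "(\<Sum>b\<in>B. ketbra b b) = mat 1"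
proof -
  let ?M = "\<Sum>b\<in>B. ketbra b b"
  have "?M *v v = v" if "v \<in> B" for v
  proof -
    have "?M *v v = (\<Sum>b\<in>B. if b = v then v else 0)"
      unfolding matrix_vector_mult_sum_left
      by (intro sum.cong) (auto simp: ketbra_vec orthonormal_basisD[OF assms] that)
    then show ?thesis
      using that finite_orthonormal_basis[OF assms] by simp
  qed
  then have "B \<subseteq> {v. ?M *v v = v}"
    by blast
  moreover have "vec.subspace {v. ?M *v v = v}"
    by (auto simp: vec.subspace_def matrix_vector_right_distrib vector_scalar_commute
        matrix_vector_mult_scaleR)
  ultimately have "vec.span B \<subseteq> {v. ?M *v v = v}"
    by (rule vec.span_minimal)
  then show ?thesis
    using orthonormal_basisD(2)[OF assms] by (auto simp: matrix_eq)
qed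

section \<open>Diagonal operators\<close>

definition diag_op :: "(complex ^ 'n) set \<Rightarrow> (complex ^ 'n \<Rightarrow> real) \<Rightarrow> complex ^ 'n ^ 'n" where
  "diag_op B p = (\<Sum>b\<in>B. p b *\<^sub>R ketbra b b)"

lemma diag_op_cong: "(\<And>b. b \<in> B \<Longrightarrow> p b = q b) \<Longrightarrow> diag_op B p = diag_op B q"
  by (simp add: diag_op_def)

lemma cadjoint_diag_op: "cadjoint (diag_op B p) = diag_op B p"
  by (simp add: diag_op_def cadjoint_simps)

lemma trace_diag_op:
  assumes "orthonormal_basis B"
  shows "trace (diag_op B p) = of_real (sum p B)"
  by (simp add: diag_op_def linear_sum[OF linear_trace]
      linear_cmul[OF linear_trace] trace_ketbra
      orthonormal_basisD[OF assms] scaleR_conv_of_real[where 'a = complex])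

lemma diag_op_ketbra:
  assumes B: "orthonormal_basis B" and b: "b \<in> B"
  shows "diag_op B p ** ketbra b b = p b *\<^sub>R ketbra b b"
    and "ketbra b b ** diag_op B p = p b *\<^sub>R ketbra b b"
proof -
  have "diag_op B p ** ketbra b b = (\<Sum>c\<in>B. if c = b then p b *\<^sub>R ketbra b b else 0)"
    unfolding diag_op_def matrix_mult.sum_left
    by (intro sum.cong) (auto simp: matrix_mult.scaleR_left ketbra_mult orthonormal_basisD[OF B] b)
  then show 1: "diag_op B p ** ketbra b b = p b *\<^sub>R ketbra b b"
    using b finite_orthonormal_basis[OF B] by simp
  show "ketbra b b ** diag_op B p = p b *\<^sub>R ketbra b b"
    using arg_cong[OF 1, of cadjoint] by (simp add: cadjoint_mult cadjoint_diag_op cadjoint_simps)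
qed

lemma commuting_is_diagonal:
  assumes B: "orthonormal_basis B" and inj: "inj_on c B"
    and comm: "diag_op B c ** D = D ** diag_op B c"
  shows "D = (\<Sum>b\<in>B. cscale (cinner b (D *v b)) (ketbra b b))"
proof -
  have off: "ketbra b b ** D ** ketbra b' b' = 0" if "b \<in> B" "b' \<in> B" "b \<noteq> b'" for b b'
  proof -
    have "ketbra b b ** (diag_op B c ** D) ** ketbra b' b' =
        ketbra b b ** (D ** diag_op B c) ** ketbra b' b'"
      by (simp only: comm)
    then have "ketbra b b ** diag_op B c ** D ** ketbra b' b' =
        ketbra b b ** D ** (diag_op B c ** ketbra b' b')"
      by (simp only: matrix_mul_assoc)
    then have "c b *\<^sub>R (ketbra b b ** D ** ketbra b' b') = c b' *\<^sub>R (ketbra b b ** D ** ketbra b' b')"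
      using that
      by (simp add: diag_op_ketbra[OF B] matrix_mult.scaleR_left matrix_mult.scaleR_right)
    then show ?thesis
      using that inj by (auto simp: inj_on_def)
  qed
  have on: "ketbra b b ** D ** ketbra b b = cscale (cinner b (D *v b)) (ketbra b b)" for b
    by (simp only: matrix_mult_ketbra[of D] ketbra_mult flip: matrix_mul_assoc)
  have "D = (\<Sum>b\<in>B. ketbra b b) ** D ** (\<Sum>b\<in>B. ketbra b b)"
    by (simp add: sum_ketbra_orthonormal_basis[OF B])
  also have "\<dots> = (\<Sum>b\<in>B. \<Sum>b'\<in>B. ketbra b b ** D ** ketbra b' b')"
    unfolding matrix_mult.sum_left matrix_mult.sum_right by (rule sum.swap)
  also have "\<dots> = (\<Sum>b\<in>B. \<Sum>b'\<in>B. if b' = b then ketbra b b ** D ** ketbra b b else 0)"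
    by (intro sum.cong) (auto simp: off)
  finally show ?thesis
    using finite_orthonormal_basis[OF B] by (simp add: on)
qed

lemma cinner_cadjoint: "cinner (cadjoint A *v u) v = cinner u (A *v v)"
proof -
  have "(\<Sum>i\<in>UNIV. \<Sum>j\<in>UNIV. A $ j $ i * (cnj (u $ j) * v $ i)) =
      (\<Sum>j\<in>UNIV. \<Sum>i\<in>UNIV. A $ j $ i * (cnj (u $ j) * v $ i))"
    by (rule sum.swap)
  then show ?thesis
    by (simp add: cinner_def cadjoint_def matrix_vector_mult_def sum_distrib_left
        sum_distrib_right algebra_simps)
qed

definition probability_on :: "'a set \<Rightarrow> ('a \<Rightarrow> real) \<Rightarrow> bool" where
  "probability_on B p \<longleftrightarrow> (\<forall>b\<in>B. 0 \<le> p b) \<and> sum p B = 1"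

lemma state_diagonalisable_in_group:
  assumes B: "orthonormal_basis B"
    and G: "closed_unitary_group G" and su: "su \<subseteq> tangent_algebra G" and \<rho>: "\<rho> \<in> states"
  shows "\<exists>U\<in>G. \<exists>p. probability_on B p \<and> conj_by U \<rho> = diag_op B p"
proof -
  obtain f :: "complex ^ 'a \<Rightarrow> nat" where "inj_on f B"
    using finite_imp_inj_to_nat_seg[OF finite_orthonormal_basis[OF B]] by auto
  then have inj: "inj_on (\<lambda>b. real (f b)) B"
    by (auto simp: inj_on_def)
  have "cadjoint \<rho> = \<rho>"
    using \<rho> by (simp add: states_def)
  then obtain U where U: "U \<in> G"
    and comm: "diag_op B (\<lambda>b. real (f b)) ** conj_by U \<rho> = conj_by U \<rho> ** diag_op B (\<lambda>b. real (f b))"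
    using critical_point_commutes[OF G su cadjoint_diag_op] by blast
  define p where "p b = Re (cinner b (conj_by U \<rho> *v b))" for b
  have nonneg: "cinner b (conj_by U \<rho> *v b) \<in> \<real>\<^sub>\<ge>\<^sub>0" for b
  proof -
    have "cinner b (conj_by U \<rho> *v b) = cinner (cadjoint U *v b) (\<rho> *v (cadjoint U *v b))"
      by (simp add: conj_by_def cinner_cadjoint flip: matrix_vector_mul_assoc)
    then show ?thesis
      using \<rho> by (simp add: states_def)
  qed
  then have "cinner b (conj_by U \<rho> *v b) = complex_of_real (p b)" for b
    by (auto simp: p_def complex_nonneg_Reals_iff complex_eq_iff)
  then have diag: "conj_by U \<rho> = diag_op B p"
    using commuting_is_diagonal[OF B inj comm] by (simp add: diag_op_def cscale_of_real)
  have "trace (diag_op B p) = 1"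
    using \<rho> trace_conj_by[OF closed_unitary_groupD(3)[OF G U], of \<rho>]
    by (simp add: states_def diag)
  then have "complex_of_real (sum p B) = 1"
    by (simp only: trace_diag_op[OF B])
  moreover have "0 \<le> p b" for b
    using nonneg[of b] by (simp add: p_def complex_nonneg_Reals_iff)
  ultimately have "probability_on B p"
    unfolding probability_on_def by (metis of_real_eq_1_iff)
  then show ?thesis
    using U diag by blast
qed

lemma reach_diag_swap:
  assumes B: "orthonormal_basis B" and su: "su \<subseteq> tangent_algebra (closure (implementable S))"
    and ij: "i \<in> B" "j \<in> B" "i \<noteq> j"
  shows "diag_op B (p \<circ> Transposition.transpose i j) \<in> reach S (diag_op B p)"
proof -
  let ?\<tau> = "Transposition.transpose i j"
  define P where "P = (1/2) *\<^sub>R ketbra (i - j) (i - j)"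
  have ii: "cinner (i - j) (i - j) = 2"
    using ij by (simp add: cinner_diff_left cinner_diff_right orthonormal_basisD[OF B])
  have "P ** P = P" "cadjoint P = P" "trace P = 1"
    by (simp_all add: P_def matrix_mult.scaleR_left matrix_mult.scaleR_right ketbra_mult ii
        cadjoint_simps trace_ketbra linear_cmul[OF linear_trace])
      (simp_all add: cscale_def vec_eq_iff scaleR_conv_of_real[where 'a = complex])
  from reflection_in_group[OF su this] obtain U where U: "U \<in> closure (implementable S)"
    and conj: "conj_by U = conj_by (mat 1 - 2 *\<^sub>R P)"
    by blast
  have refl: "(mat 1 - 2 *\<^sub>R P) *v b = ?\<tau> b" if "b \<in> B" for b
  proof -
    have "(mat 1 - 2 *\<^sub>R P) *v b = b - cinner (i - j) b *s (i - j)"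
      by (simp add: P_def matrix_vector_mult_diff_rdistrib ketbra_vec)
    then show ?thesis
      using ij that
      by (auto simp: cinner_diff_left orthonormal_basisD[OF B] Transposition.transpose_def)
  qed
  have bij: "bij_betw ?\<tau> B B"
    using ij by (intro bij_betw_byWitness[where f' = ?\<tau>]) (auto simp: Transposition.transpose_def)
  have "conj_by U (diag_op B p) = (\<Sum>b\<in>B. p b *\<^sub>R ketbra (?\<tau> b) (?\<tau> b))"
    unfolding diag_op_def conj linear_sum[OF linear_conj_by] linear_cmul[OF linear_conj_by]
    by (simp add: conj_by_ketbra refl)
  also have "\<dots> = (\<Sum>b\<in>B. p (?\<tau> (?\<tau> b)) *\<^sub>R ketbra (?\<tau> b) (?\<tau> b))"
    by simp
  also have "\<dots> = diag_op B (p \<circ> ?\<tau>)"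
    unfolding diag_op_def o_def
    by (rule sum.reindex_bij_betw[OF bij, of "\<lambda>b. p (?\<tau> b) *\<^sub>R ketbra b b"])
  finally show ?thesis
    using reach_conj_by[OF U, of "diag_op B p"] by simp
qed

section \<open>Moving mass between basis vectors\<close>

definition move_mass :: "('a \<Rightarrow> real) \<Rightarrow> 'a \<Rightarrow> 'a \<Rightarrow> real \<Rightarrow> 'a \<Rightarrow> real" where
  "move_mass p i j s b = p b + (if b = i then s * p j else 0) - (if b = j then s * p j else 0)"

lemma diag_op_move_mass:
  assumes "finite B" "i \<in> B" "j \<in> B"
  shows "diag_op B (move_mass p i j s) = diag_op B p + (s * p j) *\<^sub>R (ketbra i i - ketbra j j)"
  using assms
  by (simp add: diag_op_def move_mass_def scaleR_left_distrib scaleR_left_diff_distrib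
      sum.distrib sum_subtractf if_distrib[of "\<lambda>x. x *\<^sub>R _"] scaleR_right_diff_distrib cong: if_cong)

lemma lindblad_kernel:
  assumes "a ** X = 0" "cadjoint X = X"
  shows "lindblad a X = 0"
proof -
  have "X ** cadjoint a = 0"
    using arg_cong[OF assms(1), of cadjoint] assms(2) by (simp add: cadjoint_mult cadjoint_simps)
      (simp add: cadjoint_def vec_eq_iff)
  moreover have "cadjoint a ** a ** X = cadjoint a ** (a ** X)"
    by (simp only: matrix_mul_assoc)
  ultimately show ?thesis
    using assms(1) by (simp add: lindblad_def matrix_mult.zero_left matrix_mult.zero_right)
qed

lemma lin_exp_jump:
  assumes B: "orthonormal_basis B" and ij: "i \<in> B" "j \<in> B" "i \<noteq> j"
  shows "lin_exp (\<lambda>\<rho>. t *\<^sub>R lindblad (ketbra i j) \<rho>) (diag_op B p) =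
    diag_op B (move_mass p i j (1 - exp (- 2 * t)))"
proof -
  define F where "F \<rho> = t *\<^sub>R lindblad (ketbra i j) \<rho>" for \<rho>
  have F: "linear F"
    unfolding F_def by (rule linear_lindblad)
  note E = linear_lin_exp[OF F]
  have other: "lin_exp F (ketbra b b) = ketbra b b" if "b \<in> B" "b \<noteq> j" for b
  proof -
    have "ketbra i j ** ketbra b b = 0"
      using that ij by (simp add: ketbra_mult orthonormal_basisD[OF B])
    then have "F (ketbra b b) = 0 *\<^sub>R ketbra b b"
      by (simp add: F_def lindblad_kernel)
    then show ?thesis
      using lin_exp_eigenvector[OF F] by fastforce
  qed
  have Li: "lindblad (ketbra i j) (ketbra i i) = 0"
    using ij by (intro lindblad_kernel) (simp_all add: ketbra_mult orthonormal_basisD[OF B])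
  have Lj: "lindblad (ketbra i j) (ketbra j j) = 2 *\<^sub>R ketbra i i - 2 *\<^sub>R ketbra j j"
    using ij by (simp add: lindblad_def ketbra_mult orthonormal_basisD[OF B] cscale_of_real[of 1, simplified] scaleR_2)
  have "F (ketbra j j - ketbra i i) = (- 2 * t) *\<^sub>R (ketbra j j - ketbra i i)"
    unfolding linear_diff[OF F] unfolding F_def Li Lj by (simp add: algebra_simps)
  from lin_exp_eigenvector[OF F this]
  have "lin_exp F (ketbra j j) = ketbra i i + exp (- 2 * t) *\<^sub>R (ketbra j j - ketbra i i)"
    using ij by (simp add: linear_diff[OF E] other algebra_simps)
  then have "lin_exp F (ketbra b b) =
      ketbra b b + (if b = j then (1 - exp (- 2 * t)) *\<^sub>R (ketbra i i - ketbra j j) else 0)"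
    if "b \<in> B" for b
    using other that by (auto simp: algebra_simps)
  then have "lin_exp F (diag_op B p) = (\<Sum>b\<in>B. p b *\<^sub>R (ketbra b b +
      (if b = j then (1 - exp (- 2 * t)) *\<^sub>R (ketbra i i - ketbra j j) else 0)))"
    unfolding diag_op_def linear_sum[OF E] linear_cmul[OF E] by simp
  also have "\<dots> = diag_op B p + ((1 - exp (- 2 * t)) * p j) *\<^sub>R (ketbra i i - ketbra j j)"
    using ij finite_orthonormal_basis[OF B]
    by (simp add: diag_op_def scaleR_right_distrib sum.distrib if_distrib[of "scaleR _"] mult.commute
        cong: if_cong)
  finally show ?thesis
    using ij finite_orthonormal_basis[OF B] by (simp add: F_def[abs_def] diag_op_move_mass)
qed

lemma reach_jump:
  assumes B: "orthonormal_basis B" and ij: "i \<in> B" "j \<in> B" "i \<noteq> j"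
    and a: "ketbra i j \<in> S" and s: "0 \<le> s" "s \<le> 1"
  shows "diag_op B (move_mass p i j s) \<in> reach S (diag_op B p)"
proof -
  have "diag_op B (move_mass p i j s) \<in> reach S (diag_op B p)" if "s \<in> {0..<1}" for s
  proof -
    have "lin_exp (\<lambda>\<rho>. (- ln (1 - s) / 2) *\<^sub>R lindblad (ketbra i j) \<rho>) \<in> channels S"
      using that a by (intro channels.JU) (auto simp: ln_le_zero_iff)
    from reach_channel[OF this, of "diag_op B p"]
    have "diag_op B (move_mass p i j (1 - exp (- 2 * (- ln (1 - s) / 2)))) \<in> reach S (diag_op B p)"
      unfolding lin_exp_jump[OF B ij] .
    then show ?thesis
      using that by simp
  qed
  then have "(\<lambda>s. diag_op B (move_mass p i j s)) ` closure {0..<1} \<subseteq> reach S (diag_op B p)"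
    unfolding diag_op_move_mass[OF finite_orthonormal_basis[OF B] ij(1,2)]
    by (intro image_closure_subset continuous_intros closed_reach) auto
  then show ?thesis
    using s by auto
qed

lemma move_mass_transpose:
  fixes \<tau> :: "'a \<Rightarrow> 'a"
  assumes "\<And>b. \<tau> (\<tau> b) = b"
  shows "move_mass (p \<circ> \<tau>) (\<tau> i) (\<tau> j) s \<circ> \<tau> = move_mass p i j s"
proof -
  have "\<tau> b = \<tau> c \<longleftrightarrow> b = c" for b c
    by (metis assms)
  then show ?thesis
    by (simp add: fun_eq_iff move_mass_def assms)
qed

lemma reach_move_mass:
  assumes B: "orthonormal_basis B" and su: "su \<subseteq> tangent_algebra (closure (implementable S))"
    and kl: "k \<in> B" "l \<in> B" "k \<noteq> l"
    and move: "\<And>q. diag_op B (move_mass q (Transposition.transpose k l i)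
      (Transposition.transpose k l j) s) \<in> reach S (diag_op B q)"
  shows "diag_op B (move_mass p i j s) \<in> reach S (diag_op B p)"
proof -
  let ?\<tau> = "Transposition.transpose k l"
  have "diag_op B (move_mass (p \<circ> ?\<tau>) (?\<tau> i) (?\<tau> j) s \<circ> ?\<tau>) \<in> reach S (diag_op B p)"
    by (rule reach_trans[OF reach_trans[OF reach_diag_swap[OF B su kl] move] reach_diag_swap[OF B su kl]])
  then show ?thesis
    by (simp only: move_mass_transpose[where \<tau> = ?\<tau>, OF Transposition.transpose_involutory])
qed

lemma reach_basis_moves:
  assumes B: "orthonormal_basis B" and su: "su \<subseteq> tangent_algebra (closure (implementable S))"
    and k: "ket0 \<in> B" "ket1 \<in> B" "ket0 \<noteq> ket1" and a: "ketbra ket0 ket1 \<in> S"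
    and b: "b \<in> B" "b \<noteq> ket0" and s: "0 \<le> s" "s \<le> 1"
  shows "diag_op B (move_mass p ket0 b s) \<in> reach S (diag_op B p)"
    and "diag_op B (move_mass p b ket0 s) \<in> reach S (diag_op B p)"
proof -
  show 1: "diag_op B (move_mass p ket0 b s) \<in> reach S (diag_op B p)" for p
  proof (cases "b = ket1")
    case True
    then show ?thesis
      using reach_jump[OF B k a s] by simp
  next
    case False
    have \<tau>: "Transposition.transpose ket1 b ket0 = ket0"
      using k b by (simp add: Transposition.transpose_def)
    show ?thesis
      by (rule reach_move_mass[OF B su k(2) b(1), of ket0 b])
        (use False \<tau> reach_jump[OF B k a s] in auto)
  qed
  show "diag_op B (move_mass p b ket0 s) \<in> reach S (diag_op B p)"
    by (rule reach_move_mass[OF B su k(1) b(1), of b ket0]) (use b 1 in auto)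
qed

lemma reach_diag_diag:
  assumes B: "orthonormal_basis B" and su: "su \<subseteq> tangent_algebra (closure (implementable S))"
    and k: "ket0 \<in> B" "ket1 \<in> B" "ket0 \<noteq> ket1" and a: "ketbra ket0 ket1 \<in> S"
    and p: "probability_on B p" and q: "probability_on B q"
  shows "diag_op B q \<in> reach S (diag_op B p)"
proof -
  note moves = reach_basis_moves[OF B su k a]
  have fin: "finite (B - {ket0})" and split: "sum f B = f ket0 + sum f (B - {ket0})" for f :: "_ \<Rightarrow> real"
    using finite_orthonormal_basis[OF B] k(1) by (auto simp: sum.remove)
  have self: "diag_op B r \<in> reach S (diag_op B r)" for r
    using moves(1)[of ket1 0 r] k by (simp add: move_mass_def[abs_def] cong: if_cong)
  define collect where
    "collect F b = (if b \<in> F then 0 else if b = ket0 then p ket0 + sum p F else p b)" for F b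
  have "diag_op B (collect F) \<in> reach S (diag_op B p)" if "finite F" "F \<subseteq> B - {ket0}" for F
    using that
  proof (induction F)
    case empty
    have "collect {} = p"
      by (auto simp: collect_def)
    then show ?case
      using self by simp
  next
    case (insert x F)
    have "collect (insert x F) = move_mass (collect F) ket0 x 1"
      using insert.hyps insert.prems by (auto simp: collect_def move_mass_def fun_eq_iff)
    then have "diag_op B (collect (insert x F)) \<in> reach S (diag_op B (collect F))"
      using moves(1)[of x 1 "collect F"] insert.prems by simp
    with insert.IH show ?case
      by (rule reach_trans) (use insert.prems in auto)
  qed
  from this[OF fin] have collected: "diag_op B (collect (B - {ket0})) \<in> reach S (diag_op B p)"
    by simp
  define dist where
    "dist F b = (if b \<in> F then q b else if b = ket0 then 1 - sum q F else 0)" for F b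
  have dist: "diag_op B (dist F) \<in> reach S (diag_op B (dist {}))"
    if "finite F" "F \<subseteq> B - {ket0}" for F
    using that
  proof (induction F)
    case empty
    show ?case
      using self by simp
  next
    case (insert x F)
    have q0: "0 \<le> q b" if "b \<in> B" for b
      using q that by (simp add: probability_on_def)
    have "sum q (insert x F) \<le> sum q B"
      using insert.prems finite_orthonormal_basis[OF B] q0 by (intro sum_mono2) auto
    then have le: "q x \<le> 1 - sum q F"
      using q insert.hyps by (simp add: probability_on_def)
    \<comment> \<open>If the denominator vanishes then so does \<open>q x\<close>, and \<open>s = 0\<close> is the right value.\<close>
    define s where "s = q x / (1 - sum q F)"
    have s: "0 \<le> s" "s \<le> 1" "s * (1 - sum q F) = q x"
      using le q0[of x] insert.prems by (auto simp: s_def divide_le_eq_1)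
    have "dist (insert x F) = move_mass (dist F) x ket0 s"
      using insert.hyps insert.prems s(3) by (auto simp: dist_def move_mass_def fun_eq_iff)
    then have "diag_op B (dist (insert x F)) \<in> reach S (diag_op B (dist F))"
      using moves(2)[of x s "dist F"] insert.prems s by simp
    with insert.IH show ?case
      by (rule reach_trans) (use insert.prems in auto)
  qed
  have "diag_op B (collect (B - {ket0})) = diag_op B (dist {})"
    using p by (intro diag_op_cong) (auto simp: collect_def dist_def probability_on_def split)
  moreover have "diag_op B (dist (B - {ket0})) = diag_op B q"
    using q by (intro diag_op_cong) (auto simp: dist_def probability_on_def split)
  ultimately show ?thesis
    using reach_trans[OF collected] dist[OF fin] by auto
qed

lemma transitive_on_states_if_reach:
  assumes "\<And>\<rho> \<sigma>. \<rho> \<in> states \<Longrightarrow> \<sigma> \<in> states \<Longrightarrow> \<sigma> \<in> reach S \<rho>"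
  shows "transitive_on_states (channels S)"
  unfolding transitive_on_states_def
proof (intro ballI disjI2)
  fix \<rho> \<sigma> :: "complex ^ 'a ^ 'a" assume "\<rho> \<in> states" "\<sigma> \<in> states"
  then have "\<sigma> \<in> reach S \<rho>"
    by (rule assms)
  then obtain x where x: "\<And>n. x n \<in> (\<lambda>\<Phi>. \<Phi> \<rho>) ` channels S" "x \<longlonglongrightarrow> \<sigma>"
    unfolding reach_def closure_sequential by blast
  then obtain \<Phi> where \<Phi>: "\<And>n. \<Phi> n \<in> channels S" "\<And>n. x n = \<Phi> n \<rho>"
    unfolding image_iff by metis
  have "((\<lambda>t::real. x (nat \<lfloor>t\<rfloor>)) \<longlongrightarrow> \<sigma>) at_top"
    by (rule filterlim_compose[OF x(2)]) (rule filterlim_compose[OF filterlim_nat_sequentially filterlim_floor_sequentially])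
  then show "\<exists>T::real \<Rightarrow> _. (\<forall>t\<ge>0. T t \<in> channels S) \<and>
      ((\<exists>\<tau>>0. T \<tau> \<rho> = \<sigma>) \<or> ((\<lambda>t. T t \<rho>) \<longlongrightarrow> \<sigma>) at_top)"
    using \<Phi> by (intro exI[of _ "\<lambda>t. \<Phi> (nat \<lfloor>t\<rfloor>)"]) auto
qed

theorem theorem2p6:
  fixes S :: "(complex ^ 'n ^ 'n) set"
    and B :: "(complex ^ 'n) set"
    and ket0 ket1 :: "complex ^ 'n"
  assumes "orthonormal_basis B"
    and "ket0 \<in> B" and "ket1 \<in> B" and "ket0 \<noteq> ket1"
    and "S = cadjoint ` S"
    and "hoermander_system (cmat.span S)"
    and "ketbra ket0 ket1 \<in> S"
  shows "transitive_on_states (channels S)"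
proof (rule transitive_on_states_if_reach)
  fix \<rho> \<sigma> :: "complex ^ 'n ^ 'n" assume "\<rho> \<in> states" "\<sigma> \<in> states"
  let ?G = "closure (implementable S)"
  note G = closed_unitary_group_implementable[of S]
  have su: "su \<subseteq> tangent_algebra ?G"
    using assms(6) by (rule su_subset_tangent_algebra)
  note diagonalise = state_diagonalisable_in_group[OF assms(1) G su]
  obtain U p where U: "U \<in> ?G" "probability_on B p" "conj_by U \<rho> = diag_op B p"
    using diagonalise[OF \<open>\<rho> \<in> states\<close>] by blast
  obtain V q where V: "V \<in> ?G" "probability_on B q" "conj_by V \<sigma> = diag_op B q"
    using diagonalise[OF \<open>\<sigma> \<in> states\<close>] by blast
  have "diag_op B p \<in> reach S \<rho>"
    using reach_conj_by[OF U(1), of \<rho>] by (simp only: U(3))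
  moreover have "diag_op B q \<in> reach S (diag_op B p)"
    by (rule reach_diag_diag[OF assms(1) su assms(2-4,7) U(2) V(2)])
  moreover have "conj_by (cadjoint V) (diag_op B q) = \<sigma>"
    by (simp add: conj_by_conj_by unitary_left closed_unitary_groupD(3)[OF G V(1)] flip: V(3))
  then have "\<sigma> \<in> reach S (diag_op B q)"
    using reach_conj_by[OF closed_unitary_groupD(4)[OF G V(1)], of "diag_op B q"] by simp
  ultimately show "\<sigma> \<in> reach S \<rho>"
    by (rule reach_trans[OF reach_trans])
qed

end
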